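(* Let $N\ge1$ and let $\gamma_1,\gamma_2,V_1,V_2,\theta,\delta>0$ satisfy $\frac{V_1V_2}{\delta\gamma_1\gamma_2}>1+\frac{\theta}{\delta}$. For $k>0$ consider the homogeneous all-to-all network on the state space $\mathcal B^N$, $$\dot X_1=-(\gamma_1I_N+L)X_1+V_1X_2,\qquad \dot X_2=-\gamma_2X_2+V_2\,G(X_1),\qquad L=k\left(NI_N-\mathbb 1_N\mathbb 1_N^T\right),$$ where $X_\ell=[x_{\ell,1},\dots,x_{\ell,N}]^T$ for $\ell=1,2$, $G(X_1)=[g(x_{1,1}),\dots,g(x_{1,N})]^T$ and $$g(x)=\begin{cases}0,&x<\theta,\\ (x-\theta)/\delta,&\theta\le x\le\theta+\delta,\\ 1,&x>\theta+\delta.\end{cases}$$ (i) Let $\Omega_\alpha$ be a saturated domain with average level of activation $\overline q=m/N$, $m\in\{1,\dots,N-1\}$. Then there exists a minimum gain $k^{\overline q}$ (a finite number, depending on $\alpha$ only through $\overline q$) such that for all $k>k^{\overline q}$ no equilibria of the system are contained in $\Omega_\alpha$. (ii) There exists $k^s>0$ such that for every $k>k^s$, if an equilibrium exists in a saturated domain, then it is synchronized.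
   Context: $\mathbb 1_N\in\mathbb R^N$ is the all-ones vector. The state space is $\mathcal B^N=\prod_{i=1}^N\mathcal B$, where $\mathcal B=[0,\bar x_1]\times[0,\bar x_2]$ with $\bar x_1,\bar x_2>0$ is a fixed box (independent of $k$) that is forward invariant for the uncoupled compartment $\dot x_1=-\gamma_1x_1+V_1x_2$, $\dot x_2=-\gamma_2x_2+V_2g(x_1)$; the $i$-th factor contains $(x_{1,i},x_{2,i})$. For $\alpha\in\{-1,0,1\}^N$ the domain $\Omega_\alpha$ is the set of $x\in\mathcal B^N$ such that, for every $j$: $x_{1,j}>\theta+\delta$ if $\alpha_j=1$; $x_{1,j}<\theta$ if $\alpha_j=-1$; $\theta\le x_{1,j}\le\theta+\delta$ if $\alpha_j=0$. The domain is called saturated if $\alpha_j\in\{-1,1\}$ for all $j$. A saturated domain $\Omega_\alpha$ has average level of activation $\overline q=m/N$, where $m$ is the number of entries of $\alpha$ equal to $1$. An equilibrium $\overline X=[\overline X_1,\overline X_2]$ is called synchronized if $\overline X_1\in\operatorname{span}\{\mathbb 1_N\}$ and $\overline X_2\in\operatorname{span}\{\mathbb 1_N\}$. *)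

theory Defs
  imports "HOL-Analysis.Analysis"
begin

definition ramp :: "real \<Rightarrow> real \<Rightarrow> real \<Rightarrow> real" where
  "ramp \<theta> \<delta> x =
     (if x < \<theta> then 0 else if x \<le> \<theta> + \<delta> then (x - \<theta>) / \<delta> else 1)"

definition compartment_field ::
  "real \<Rightarrow> real \<Rightarrow> real \<Rightarrow> real \<Rightarrow> real \<Rightarrow> real \<Rightarrow> real \<times> real \<Rightarrow> real \<times> real" where
  "compartment_field \<gamma>1 \<gamma>2 V1 V2 \<theta> \<delta> =
     (\<lambda>(x1, x2). (- \<gamma>1 * x1 + V1 * x2, - \<gamma>2 * x2 + V2 * ramp \<theta> \<delta> x1))"

(* Quantifying over solutions on every compact time interval {0..T} also covers
   solutions on the half-line, and needs no global existence result. *)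
definition forward_invariant :: "('a::real_normed_vector \<Rightarrow> 'a) \<Rightarrow> 'a set \<Rightarrow> bool" where
  "forward_invariant f S \<longleftrightarrow>
     (\<forall>T x. (\<forall>t\<in>{0..T}. (x has_vector_derivative f (x t)) (at t within {0..T}))
        \<longrightarrow> x 0 \<in> S \<longrightarrow> (\<forall>t\<in>{0..T}. x t \<in> S))"

definition compartment_box :: "real \<Rightarrow> real \<Rightarrow> (real \<times> real) set" where
  "compartment_box b1 b2 = {0..b1} \<times> {0..b2}"

definition state_space :: "real \<Rightarrow> real \<Rightarrow> ((real ^ 'n) \<times> (real ^ 'n)) set" where
  "state_space b1 b2 = {(X1, X2). \<forall>i. (X1 $ i, X2 $ i) \<in> compartment_box b1 b2}"

(* The constant 1 of type real ^ 'n is the all-ones vector, mat 1 the identity matrix. *)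
definition all_to_all_laplacian :: "real \<Rightarrow> real ^ 'n ^ 'n" where
  "all_to_all_laplacian k =
     k *\<^sub>R (real CARD('n) *\<^sub>R mat 1
       - (columnvector (1 :: real ^ 'n) :: real ^ 1 ^ 'n) ** rowvector (1 :: real ^ 'n))"

definition network_field ::
  "real \<Rightarrow> real \<Rightarrow> real \<Rightarrow> real \<Rightarrow> real \<Rightarrow> real \<Rightarrow> real
    \<Rightarrow> (real ^ 'n) \<times> (real ^ 'n) \<Rightarrow> (real ^ 'n) \<times> (real ^ 'n)" where
  "network_field \<gamma>1 \<gamma>2 V1 V2 \<theta> \<delta> k =
     (\<lambda>(X1, X2).
        (- ((\<gamma>1 *\<^sub>R mat 1 + all_to_all_laplacian k) *v X1) + V1 *\<^sub>R X2,
         - (\<gamma>2 *\<^sub>R X2) + V2 *\<^sub>R (\<chi> i. ramp \<theta> \<delta> (X1 $ i))))"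

definition equilibria ::
  "real \<Rightarrow> real \<Rightarrow> real \<Rightarrow> real \<Rightarrow> real \<Rightarrow> real \<Rightarrow> real \<Rightarrow> real \<Rightarrow> real
    \<Rightarrow> ((real ^ 'n) \<times> (real ^ 'n)) set" where
  "equilibria \<gamma>1 \<gamma>2 V1 V2 \<theta> \<delta> b1 b2 k =
     {X \<in> state_space b1 b2. network_field \<gamma>1 \<gamma>2 V1 V2 \<theta> \<delta> k X = 0}"

(* Meaningful for sign vectors \<alpha> with entries in {-1, 0, 1}. *)
definition activation_domain ::
  "real \<Rightarrow> real \<Rightarrow> real \<Rightarrow> real \<Rightarrow> int ^ 'n \<Rightarrow> ((real ^ 'n) \<times> (real ^ 'n)) set" where
  "activation_domain \<theta> \<delta> b1 b2 \<alpha> =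
     {(X1, X2) \<in> state_space b1 b2. \<forall>j.
        (\<alpha> $ j = 1 \<longrightarrow> X1 $ j > \<theta> + \<delta>) \<and>
        (\<alpha> $ j = -1 \<longrightarrow> X1 $ j < \<theta>) \<and>
        (\<alpha> $ j = 0 \<longrightarrow> \<theta> \<le> X1 $ j \<and> X1 $ j \<le> \<theta> + \<delta>)}"

definition saturated :: "int ^ 'n \<Rightarrow> bool" where
  "saturated \<alpha> \<longleftrightarrow> (\<forall>j. \<alpha> $ j \<in> {-1, 1})"

definition num_active :: "int ^ 'n \<Rightarrow> nat" where
  "num_active \<alpha> = card {j. \<alpha> $ j = 1}"

definition avg_activation :: "int ^ 'n \<Rightarrow> real" where
  "avg_activation \<alpha> = real (num_active \<alpha>) / real CARD('n)"

definition synchronized :: "(real ^ 'n) \<times> (real ^ 'n) \<Rightarrow> bool" where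
  "synchronized X \<longleftrightarrow> fst X \<in> span {1} \<and> snd X \<in> span {1}"

(* Nonnegative gains above which no equilibrium lies in the domain of \<alpha>; the coupling
   gain is positive, so negative thresholds carry no information. *)
definition exclusion_gains ::
  "real \<Rightarrow> real \<Rightarrow> real \<Rightarrow> real \<Rightarrow> real \<Rightarrow> real \<Rightarrow> real \<Rightarrow> real
    \<Rightarrow> int ^ 'n \<Rightarrow> real set" where
  "exclusion_gains \<gamma>1 \<gamma>2 V1 V2 \<theta> \<delta> b1 b2 \<alpha> =
     {k0. 0 \<le> k0 \<and>
        (\<forall>k>k0. equilibria \<gamma>1 \<gamma>2 V1 V2 \<theta> \<delta> b1 b2 k \<inter> activation_domain \<theta> \<delta> b1 b2 \<alpha> = {})}"

end

theory Submission
  imports Defs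
begin

text \<open>
  In a saturated domain the ramp only takes the values 0 and 1, so an equilibrium solves a linear
  system. Write \<open>n\<close> for the number of compartments, \<open>m\<close> for the number of active ones and
  \<open>a\<^sub>j \<in> {0, 1}\<close> for the activity of compartment \<open>j\<close>. The second equation gives
  \<open>x\<^sub>2\<^sub>j = V2 a\<^sub>j / \<gamma>2\<close>. Summing the first equation over all compartments removes the coupling,
  because the columns of the Laplacian add up to zero, and so determines the total of the
  \<open>x\<^sub>1\<^sub>j\<close>; hence
  \<open>x\<^sub>1\<^sub>j = V1 V2 / \<gamma>2 * (a\<^sub>j + k m / \<gamma>1) / (\<gamma>1 + k n)\<close> (lemma \<open>saturated_equilibrium_iff\<close>).

  Consequently there are just two levels, differing by \<open>V1 V2 / (\<gamma>2 (\<gamma>1 + k n))\<close>. If both occur,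
  one lies above \<open>\<theta> + \<delta>\<close> and the other below \<open>\<theta>\<close>, so their difference exceeds \<open>\<delta>\<close>, which is
  impossible once \<open>k \<ge> V1 V2 / (\<gamma>2 \<delta> n)\<close> (lemma \<open>levels_merge\<close>). Above this gain an
  equilibrium in a saturated domain has a single level, that is, it is synchronized.

  For a fixed mixed domain, whether the two levels are compatible with the domain and the box is a
  condition on \<open>m\<close> and \<open>k\<close> alone (lemma \<open>mixed_equilibrium_exists_iff\<close>), which is why the
  minimum gain depends on the average activation only. The minimum is attained because the
  exclusion condition ranges over the strict upper interval \<open>k > k0\<close>
  (lemma \<open>Inf_strict_threshold\<close>).
\<close>

section \<open>Componentwise form of the equilibrium equations\<close>

lemma all_to_all_laplacian_mult_nth:
  fixes X :: "real ^ 'n"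
  shows "(all_to_all_laplacian k *v X) $ i = k * (real CARD('n) * X $ i - (\<Sum>j\<in>UNIV. X $ j))"
proof -
  have rank_one: "(columnvector (1 :: real ^ 'n) :: real ^ 1 ^ 'n) ** rowvector (1 :: real ^ 'n)
      = (\<chi> i j. 1)"
    by (simp add: vec_eq_iff matrix_matrix_mult_def columnvector_def rowvector_def)
  have "(((\<chi> i j. 1) :: real ^ 'n ^ 'n) *v X) $ i = (\<Sum>j\<in>UNIV. X $ j)"
    by (simp add: matrix_vector_mult_def)
  then show ?thesis
    unfolding all_to_all_laplacian_def rank_one
    by (simp add: matrix_vector_mult_diff_rdistrib scaleR_matrix_vector_assoc [symmetric])
qed

lemma network_field_eq_0_iff:
  fixes X1 X2 :: "real ^ 'n"
  shows "network_field \<gamma>1 \<gamma>2 V1 V2 \<theta> \<delta> k (X1, X2) = 0 \<longleftrightarrow>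
    (\<forall>i. \<gamma>1 * X1 $ i + k * (real CARD('n) * X1 $ i - (\<Sum>j\<in>UNIV. X1 $ j)) = V1 * X2 $ i
       \<and> \<gamma>2 * X2 $ i = V2 * ramp \<theta> \<delta> (X1 $ i))"
proof -
  have "((\<gamma>1 *\<^sub>R mat 1 + all_to_all_laplacian k) *v X1) $ i
      = \<gamma>1 * X1 $ i + k * (real CARD('n) * X1 $ i - (\<Sum>j\<in>UNIV. X1 $ j))" for i
    by (simp add: matrix_vector_mult_add_rdistrib scaleR_matrix_vector_assoc [symmetric]
        all_to_all_laplacian_mult_nth)
  then show ?thesis
    by (auto simp: network_field_def vec_eq_iff prod_eq_iff)
qed

section \<open>Equilibria in saturated domains\<close>

definition activity :: "int ^ 'n \<Rightarrow> 'n \<Rightarrow> real" where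
  "activity \<alpha> j = of_bool (\<alpha> $ j = 1)"

lemma sum_activity: "(\<Sum>j\<in>UNIV. activity \<alpha> j) = real (num_active \<alpha>)"
  by (simp add: activity_def num_active_def)

lemma ramp_saturated:
  assumes "\<delta> > 0" "saturated \<alpha>" "(X1, X2) \<in> activation_domain \<theta> \<delta> b1 b2 \<alpha>"
  shows "ramp \<theta> \<delta> (X1 $ j) = activity \<alpha> j"
proof -
  have "\<alpha> $ j = 1 \<or> \<alpha> $ j = -1"
    using assms(2) by (auto simp: saturated_def)
  then show ?thesis
    using assms(1,3) by (auto simp: activation_domain_def ramp_def activity_def)
qed

text \<open>
  The value of \<open>x\<^sub>1\<close> at equilibrium for a compartment of activity \<open>a\<close>, when \<open>m\<close> of the \<open>n\<close>
  compartments are active. The argument \<open>m\<close> is real so that it can be recovered from an average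
  level of activation.
\<close>

definition level :: "real \<Rightarrow> real \<Rightarrow> real \<Rightarrow> real \<Rightarrow> real \<Rightarrow> real \<Rightarrow> real \<Rightarrow> real \<Rightarrow> real" where
  "level \<gamma>1 \<gamma>2 V1 V2 n k m a = V1 * V2 / \<gamma>2 * (a + k * m / \<gamma>1) / (\<gamma>1 + k * n)"

text \<open>
  Summing the equations cancels the coupling and leaves \<open>\<gamma>1 * (\<Sum>j. x j) = (\<Sum>j. f j)\<close>; once the
  sum of the unknowns is known, every equation determines its own coordinate.
\<close>

lemma mean_field_system_iff:
  fixes x f :: "'n::finite \<Rightarrow> real"
  assumes "\<gamma>1 > 0" "k \<ge> 0"
  shows "(\<forall>i. \<gamma>1 * x i + k * (real CARD('n) * x i - (\<Sum>j\<in>UNIV. x j)) = f i) \<longleftrightarrow>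
    (\<forall>i. x i = (f i + k * (\<Sum>j\<in>UNIV. f j) / \<gamma>1) / (\<gamma>1 + k * real CARD('n)))"
    (is "?L \<longleftrightarrow> ?R")
proof -
  let ?n = "real CARD('n)"
  have pos: "\<gamma>1 + k * ?n > 0"
    using assms by (simp add: add_pos_nonneg)
  have solve: "\<gamma>1 * y + k * (?n * y - s) = c \<longleftrightarrow> y = (c + k * s) / (\<gamma>1 + k * ?n)" for y s c
    using pos by (auto simp: field_simps)
  show ?thesis
  proof
    assume L: ?L
    have "(\<Sum>j\<in>UNIV. f j)
        = (\<Sum>i\<in>UNIV. \<gamma>1 * x i + k * (?n * x i - (\<Sum>j\<in>UNIV. x j)))"
      using L by simp
    also have "\<dots> = \<gamma>1 * (\<Sum>j\<in>UNIV. x j)"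
      by (simp add: sum.distrib sum_subtractf sum_distrib_left [symmetric])
    finally have "(\<Sum>j\<in>UNIV. x j) = (\<Sum>j\<in>UNIV. f j) / \<gamma>1"
      using assms(1) by (simp add: field_simps)
    with L show ?R
      by (simp add: solve)
  next
    assume R: ?R
    have "(\<Sum>j\<in>UNIV. x j)
        = (\<Sum>j\<in>UNIV. f j + k * (\<Sum>j\<in>UNIV. f j) / \<gamma>1) / (\<gamma>1 + k * ?n)"
      using R by (simp add: sum_divide_distrib)
    also have "(\<Sum>j\<in>UNIV. f j + k * (\<Sum>j\<in>UNIV. f j) / \<gamma>1)
        = (\<Sum>j\<in>UNIV. f j) / \<gamma>1 * (\<gamma>1 + k * ?n)"
      unfolding sum.distrib using assms(1) by (simp add: field_simps)
    also have "\<dots> / (\<gamma>1 + k * ?n) = (\<Sum>j\<in>UNIV. f j) / \<gamma>1"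
      using pos by simp
    finally show ?L
      unfolding solve using R by simp
  qed
qed

text \<open>
  Membership in the domain replaces the ramp by the constant activities, which turns the
  equilibrium equations into an invertible linear system.
\<close>

lemma saturated_equilibrium_iff:
  fixes X1 X2 :: "real ^ 'n" and \<alpha> :: "int ^ 'n"
  assumes "\<gamma>1 > 0" "\<gamma>2 > 0" "\<delta> > 0" "k \<ge> 0" "saturated \<alpha>"
    and dom: "(X1, X2) \<in> activation_domain \<theta> \<delta> b1 b2 \<alpha>"
  shows "(X1, X2) \<in> equilibria \<gamma>1 \<gamma>2 V1 V2 \<theta> \<delta> b1 b2 k \<longleftrightarrow>
    (\<forall>i. X1 $ i = level \<gamma>1 \<gamma>2 V1 V2 (real CARD('n)) k (real (num_active \<alpha>)) (activity \<alpha> i)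
       \<and> X2 $ i = V2 / \<gamma>2 * activity \<alpha> i)"
proof -
  have state: "(X1, X2) \<in> state_space b1 b2"
    using dom by (simp add: activation_domain_def)
  let ?c = "V1 * V2 / \<gamma>2"
  have "(X1, X2) \<in> equilibria \<gamma>1 \<gamma>2 V1 V2 \<theta> \<delta> b1 b2 k \<longleftrightarrow>
      (\<forall>i. \<gamma>1 * X1 $ i + k * (real CARD('n) * X1 $ i - (\<Sum>j\<in>UNIV. X1 $ j)) = V1 * X2 $ i
       \<and> \<gamma>2 * X2 $ i = V2 * activity \<alpha> i)"
    using state ramp_saturated [OF assms(3,5) dom]
    by (simp add: equilibria_def network_field_eq_0_iff)
  also have "\<dots> \<longleftrightarrow>
      (\<forall>i. \<gamma>1 * X1 $ i + k * (real CARD('n) * X1 $ i - (\<Sum>j\<in>UNIV. X1 $ j)) = ?c * activity \<alpha> i)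
       \<and> (\<forall>i. X2 $ i = V2 / \<gamma>2 * activity \<alpha> i)"
  proof -
    have x2: "\<gamma>2 * X2 $ i = V2 * activity \<alpha> i \<longleftrightarrow> X2 $ i = V2 / \<gamma>2 * activity \<alpha> i" for i
      using assms(2) by (auto simp: field_simps)
    show ?thesis
      unfolding x2 by (auto simp: mult.assoc)
  qed
  also have "\<dots> \<longleftrightarrow>
      (\<forall>i. X1 $ i = level \<gamma>1 \<gamma>2 V1 V2 (real CARD('n)) k (real (num_active \<alpha>)) (activity \<alpha> i))
       \<and> (\<forall>i. X2 $ i = V2 / \<gamma>2 * activity \<alpha> i)"
    unfolding mean_field_system_iff [OF assms(1,4)] level_def
    unfolding sum_distrib_left [symmetric] sum_activity by (simp add: algebra_simps)
  finally show ?thesis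
    by blast
qed

section \<open>Coexistence of active and inactive compartments\<close>

text \<open>
  The constraints that a mixed saturated domain and the box put on the two levels. They mention
  the domain only through the number \<open>m\<close> of active compartments.
\<close>

definition levels_coexist ::
  "real \<Rightarrow> real \<Rightarrow> real \<Rightarrow> real \<Rightarrow> real \<Rightarrow> real \<Rightarrow> real \<Rightarrow> real
    \<Rightarrow> real \<Rightarrow> real \<Rightarrow> real \<Rightarrow> bool" where
  "levels_coexist \<gamma>1 \<gamma>2 V1 V2 \<theta> \<delta> b1 b2 n m k \<longleftrightarrow>
     (let u = level \<gamma>1 \<gamma>2 V1 V2 n k m 1; v = level \<gamma>1 \<gamma>2 V1 V2 n k m 0
      in \<theta> + \<delta> < u \<and> v < \<theta> \<and>
         (u, V2 / \<gamma>2) \<in> compartment_box b1 b2 \<and> (v, 0) \<in> compartment_box b1 b2)"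

text \<open>
  Both levels occur in a mixed domain, so an equilibrium forces the constraints; conversely,
  placing the two levels according to \<open>\<alpha>\<close> produces an equilibrium.
\<close>

lemma mixed_equilibrium_exists_iff:
  fixes \<alpha> :: "int ^ 'n"
  assumes "\<gamma>1 > 0" "\<gamma>2 > 0" "\<delta> > 0" "k \<ge> 0" "saturated \<alpha>"
    and m: "num_active \<alpha> \<in> {1..CARD('n) - 1}"
  shows "equilibria \<gamma>1 \<gamma>2 V1 V2 \<theta> \<delta> b1 b2 k \<inter> activation_domain \<theta> \<delta> b1 b2 \<alpha> \<noteq> {} \<longleftrightarrow>
    levels_coexist \<gamma>1 \<gamma>2 V1 V2 \<theta> \<delta> b1 b2 (real CARD('n)) (real (num_active \<alpha>)) k"
    (is "?E \<longleftrightarrow> ?C")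
proof -
  let ?lev = "level \<gamma>1 \<gamma>2 V1 V2 (real CARD('n)) k (real (num_active \<alpha>))"
  have sat: "\<alpha> $ j = 1 \<or> \<alpha> $ j = -1" for j
    using assms(5) by (auto simp: saturated_def)
  show ?thesis
  proof
    assume ?E
    then obtain X1 X2 where eq: "(X1, X2) \<in> equilibria \<gamma>1 \<gamma>2 V1 V2 \<theta> \<delta> b1 b2 k"
      and dom: "(X1, X2) \<in> activation_domain \<theta> \<delta> b1 b2 \<alpha>"
      by auto
    have vals: "X1 $ i = ?lev (activity \<alpha> i)" "X2 $ i = V2 / \<gamma>2 * activity \<alpha> i" for i
      using saturated_equilibrium_iff [OF assms(1-5) dom] eq by blast+
    have "0 < card {j. \<alpha> $ j = 1}" "card {j. \<alpha> $ j = 1} < CARD('n)"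
      using m by (auto simp: num_active_def)
    then have "{j. \<alpha> $ j = 1} \<noteq> {}" "{j. \<alpha> $ j = 1} \<noteq> UNIV"
      by (metis card.empty less_irrefl, metis less_irrefl)
    then obtain i j where "\<alpha> $ i = 1" "\<alpha> $ j = -1"
      using sat by blast
    moreover have bounds: "(X1 $ i, X2 $ i) \<in> compartment_box b1 b2"
        "\<alpha> $ i = 1 \<Longrightarrow> \<theta> + \<delta> < X1 $ i" "\<alpha> $ i = -1 \<Longrightarrow> X1 $ i < \<theta>" for i
      using dom by (auto simp: activation_domain_def state_space_def)
    ultimately show ?C
      using vals [of i] vals [of j] bounds [of i] bounds [of j]
      by (simp add: levels_coexist_def Let_def activity_def)
  next
    assume C: ?C
    define X1 :: "real ^ 'n" where "X1 = (\<chi> i. ?lev (activity \<alpha> i))"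
    define X2 :: "real ^ 'n" where "X2 = (\<chi> i. V2 / \<gamma>2 * activity \<alpha> i)"
    have "(X1 $ j, X2 $ j) \<in> compartment_box b1 b2"
        "\<alpha> $ j = 1 \<Longrightarrow> \<theta> + \<delta> < X1 $ j" "\<alpha> $ j = -1 \<Longrightarrow> X1 $ j < \<theta>" "\<alpha> $ j \<noteq> 0" for j
      using C sat [of j] by (auto simp: levels_coexist_def Let_def X1_def X2_def activity_def)
    then have dom: "(X1, X2) \<in> activation_domain \<theta> \<delta> b1 b2 \<alpha>"
      by (simp add: activation_domain_def state_space_def)
    have "(X1, X2) \<in> equilibria \<gamma>1 \<gamma>2 V1 V2 \<theta> \<delta> b1 b2 k"
      using saturated_equilibrium_iff [OF assms(1-5) dom] by (simp add: X1_def X2_def)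
    with dom show ?E
      by blast
  qed
qed

lemma levels_merge:
  assumes "\<gamma>1 > 0" "\<gamma>2 > 0" "V1 > 0" "V2 > 0" "\<delta> > 0" "n > 0"
    and k: "k \<ge> V1 * V2 / (\<gamma>2 * \<delta> * n)"
  shows "\<not> levels_coexist \<gamma>1 \<gamma>2 V1 V2 \<theta> \<delta> b1 b2 n m k"
proof
  assume "levels_coexist \<gamma>1 \<gamma>2 V1 V2 \<theta> \<delta> b1 b2 n m k"
  then have gap: "\<delta> < level \<gamma>1 \<gamma>2 V1 V2 n k m 1 - level \<gamma>1 \<gamma>2 V1 V2 n k m 0"
    by (auto simp: levels_coexist_def Let_def)
  have "0 < V1 * V2 / (\<gamma>2 * \<delta> * n)"
    using assms by simp
  then have pos: "0 < \<gamma>1 + k * n"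
    using assms(1,6) k by (intro add_pos_pos mult_pos_pos) auto
  have "level \<gamma>1 \<gamma>2 V1 V2 n k m 1 - level \<gamma>1 \<gamma>2 V1 V2 n k m 0 = V1 * V2 / \<gamma>2 / (\<gamma>1 + k * n)"
    unfolding level_def diff_divide_distrib [symmetric] right_diff_distrib [symmetric] by simp
  with gap pos have "\<delta> * (\<gamma>1 + k * n) < V1 * V2 / \<gamma>2"
    by (metis pos_less_divide_eq)
  moreover have "V1 * V2 / \<gamma>2 \<le> \<delta> * (k * n)"
    using k assms by (simp add: field_simps)
  moreover have "\<delta> * (\<gamma>1 + k * n) = \<delta> * \<gamma>1 + \<delta> * (k * n)" "0 < \<delta> * \<gamma>1"
    using assms by (simp_all add: algebra_simps)
  ultimately show False
    by linarith
qed

lemma synchronized_iff: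
  fixes X :: "(real ^ 'n) \<times> (real ^ 'n)"
  shows "synchronized X \<longleftrightarrow> (\<exists>a. \<forall>i. fst X $ i = a) \<and> (\<exists>b. \<forall>i. snd X $ i = b)"
proof -
  have "x \<in> span {1} \<longleftrightarrow> (\<exists>c. \<forall>i. x $ i = c)" for x :: "real ^ 'n"
    by (simp add: span_singleton image_iff vec_eq_iff)
  then show ?thesis
    by (simp add: synchronized_def)
qed

lemma uniform_equilibrium_synchronized:
  fixes \<alpha> :: "int ^ 'n"
  assumes "\<gamma>1 > 0" "\<gamma>2 > 0" "\<delta> > 0" "k \<ge> 0" "saturated \<alpha>"
    and unif: "num_active \<alpha> \<notin> {1..CARD('n) - 1}"
    and X: "X \<in> equilibria \<gamma>1 \<gamma>2 V1 V2 \<theta> \<delta> b1 b2 k \<inter> activation_domain \<theta> \<delta> b1 b2 \<alpha>"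
  shows "synchronized X"
proof -
  have "num_active \<alpha> \<le> CARD('n)"
    unfolding num_active_def by (intro card_mono) auto
  with unif have "num_active \<alpha> = 0 \<or> num_active \<alpha> = CARD('n)"
    by auto
  then have "{j. \<alpha> $ j = 1} = {} \<or> {j. \<alpha> $ j = 1} = UNIV"
    unfolding num_active_def by (metis card_0_eq card_subset_eq finite subset_UNIV)
  then have "\<exists>a. \<forall>j. activity \<alpha> j = a"
    by (auto simp: activity_def)
  then show ?thesis
    using X saturated_equilibrium_iff [OF assms(1-5), of "fst X" "snd X"]
    by (auto simp: synchronized_iff)
qed

section \<open>The minimum gain\<close>

text \<open>
  Any \<open>k\<close> above the infimum is above some element of \<open>S\<close>, so \<open>P k\<close> holds; the infimum itself need
  not satisfy \<open>P\<close>, and the strict comparison does not ask for it.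
\<close>

lemma Inf_strict_threshold:
  fixes P :: "real \<Rightarrow> bool"
  defines "S \<equiv> {k0. 0 \<le> k0 \<and> (\<forall>k>k0. P k)}"
  assumes ne: "S \<noteq> {}"
  shows "Inf S \<in> S" and "k0 \<in> S \<Longrightarrow> Inf S \<le> k0"
proof -
  have bdd: "bdd_below S"
    by (rule bdd_belowI [of _ 0]) (simp add: S_def)
  have "0 \<le> Inf S"
    by (rule cInf_greatest [OF ne]) (simp add: S_def)
  moreover have "P k" if "k > Inf S" for k
    using that cInf_less_iff [OF ne bdd] by (auto simp: S_def)
  ultimately show "Inf S \<in> S"
    by (simp add: S_def)
  show "Inf S \<le> k0" if "k0 \<in> S"
    using that bdd by (rule cInf_lower)
qed

lemma exclusion_gains_mixed:
  fixes \<alpha> :: "int ^ 'n"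
  assumes "\<gamma>1 > 0" "\<gamma>2 > 0" "\<delta> > 0" "saturated \<alpha>" "num_active \<alpha> \<in> {1..CARD('n) - 1}"
  shows "exclusion_gains \<gamma>1 \<gamma>2 V1 V2 \<theta> \<delta> b1 b2 \<alpha> =
    {k0. 0 \<le> k0 \<and> (\<forall>k>k0.
      \<not> levels_coexist \<gamma>1 \<gamma>2 V1 V2 \<theta> \<delta> b1 b2 (real CARD('n)) (real (num_active \<alpha>)) k)}"
proof -
  have "equilibria \<gamma>1 \<gamma>2 V1 V2 \<theta> \<delta> b1 b2 k \<inter> activation_domain \<theta> \<delta> b1 b2 \<alpha> = {} \<longleftrightarrow>
      \<not> levels_coexist \<gamma>1 \<gamma>2 V1 V2 \<theta> \<delta> b1 b2 (real CARD('n)) (real (num_active \<alpha>)) k"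
    if "0 \<le> k" for k
    using mixed_equilibrium_exists_iff [OF assms(1-3) that assms(4,5), of V1 V2 \<theta> b1 b2]
    by argo
  then show ?thesis
    unfolding exclusion_gains_def by (intro Collect_cong conj_cong refl) simp
qed

theorem theoremV1:
  fixes \<gamma>1 \<gamma>2 V1 V2 \<theta> \<delta> b1 b2 :: real
  assumes "\<gamma>1 > 0" "\<gamma>2 > 0" "V1 > 0" "V2 > 0" "\<theta> > 0" "\<delta> > 0"
    and "b1 > 0" "b2 > 0"
    and "forward_invariant (compartment_field \<gamma>1 \<gamma>2 V1 V2 \<theta> \<delta>) (compartment_box b1 b2)"
    and "V1 * V2 / (\<delta> * \<gamma>1 * \<gamma>2) > 1 + \<theta> / \<delta>"
  shows "(\<exists>kq :: real \<Rightarrow> real. \<forall>\<alpha> :: int ^ 'n.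
            saturated \<alpha> \<and> num_active \<alpha> \<in> {1..CARD('n) - 1} \<longrightarrow>
              kq (avg_activation \<alpha>) \<in> exclusion_gains \<gamma>1 \<gamma>2 V1 V2 \<theta> \<delta> b1 b2 \<alpha> \<and>
              (\<forall>k0 \<in> exclusion_gains \<gamma>1 \<gamma>2 V1 V2 \<theta> \<delta> b1 b2 \<alpha>. kq (avg_activation \<alpha>) \<le> k0))
       \<and> (\<exists>ks>0. \<forall>k>ks. \<forall>\<alpha> :: int ^ 'n. saturated \<alpha> \<longrightarrow>
            (\<forall>X \<in> equilibria \<gamma>1 \<gamma>2 V1 V2 \<theta> \<delta> b1 b2 k \<inter> activation_domain \<theta> \<delta> b1 b2 \<alpha>.
               synchronized X))"
proof -
  let ?n = "real CARD('n)"
  let ?ks = "V1 * V2 / (\<gamma>2 * \<delta> * ?n)"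
  have ks_pos: "?ks > 0"
    using assms by simp
  have merge: "\<not> levels_coexist \<gamma>1 \<gamma>2 V1 V2 \<theta> \<delta> b1 b2 ?n m k" if "k > ?ks" for m k
    using that assms by (intro levels_merge) auto
  define gains where "gains m = {k0. 0 \<le> k0 \<and>
      (\<forall>k>k0. \<not> levels_coexist \<gamma>1 \<gamma>2 V1 V2 \<theta> \<delta> b1 b2 ?n m k)}" for m
  have ne: "gains m \<noteq> {}" for m
  proof -
    have "?ks \<in> gains m"
      unfolding gains_def using merge less_imp_le [OF ks_pos] by blast
    then show ?thesis
      by blast
  qed
  define kq where "kq q = Inf (gains (q * ?n))" for q
  have part1: "kq (avg_activation \<alpha>) \<in> exclusion_gains \<gamma>1 \<gamma>2 V1 V2 \<theta> \<delta> b1 b2 \<alpha> \<and>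
      (\<forall>k0 \<in> exclusion_gains \<gamma>1 \<gamma>2 V1 V2 \<theta> \<delta> b1 b2 \<alpha>. kq (avg_activation \<alpha>) \<le> k0)"
    if "saturated \<alpha>" "num_active \<alpha> \<in> {1..CARD('n) - 1}" for \<alpha> :: "int ^ 'n"
  proof -
    have "avg_activation \<alpha> * ?n = real (num_active \<alpha>)"
      by (simp add: avg_activation_def)
    then have "kq (avg_activation \<alpha>) = Inf (gains (real (num_active \<alpha>)))"
      by (simp add: kq_def)
    moreover have "exclusion_gains \<gamma>1 \<gamma>2 V1 V2 \<theta> \<delta> b1 b2 \<alpha> = gains (real (num_active \<alpha>))"
      unfolding gains_def by (rule exclusion_gains_mixed [OF assms(1,2,6) that])
    ultimately show ?thesis
      using Inf_strict_threshold [OF ne [unfolded gains_def], folded gains_def] by simp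
  qed
  have part2: "synchronized X"
    if k: "k > ?ks" and sat: "saturated \<alpha>"
      and X: "X \<in> equilibria \<gamma>1 \<gamma>2 V1 V2 \<theta> \<delta> b1 b2 k \<inter> activation_domain \<theta> \<delta> b1 b2 \<alpha>"
    for k X and \<alpha> :: "int ^ 'n"
  proof -
    have "k \<ge> 0"
      using k ks_pos by linarith
    moreover from this have "num_active \<alpha> \<notin> {1..CARD('n) - 1}"
      using mixed_equilibrium_exists_iff [OF assms(1,2,6) _ sat] merge [OF k] X by blast
    ultimately show ?thesis
      using uniform_equilibrium_synchronized [OF assms(1,2,6) _ sat _ X] by simp
  qed
  show ?thesis
    by (intro conjI exI [of _ kq] exI [of _ ?ks] allI impI ballI ks_pos) (use part1 part2 in auto)
qed

end
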